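(* Let $D=\{s\in\mathbb{C}: 1/2<\Re(s)<1\}$ and let $L(s)$ be a function on $D$ which is hybridly universal. Let $P_s\in\mathcal{D}_s[X]$ be a polynomial of degree greater than zero which is not a monomial. Then the function $P_s(L(s))$ has infinitely many zeros in $D$. More precisely, for any $1/2<\sigma_1<\sigma_2<1$ there exists a constant $C>0$ such that for all sufficiently large $T$, the function $P_s(L(s))$ has more than $CT$ zeros in the rectangle $\sigma_1<\sigma<\sigma_2$, $0<t<T$ (where $s=\sigma+it$). Moreover, if $L(s)$ is hybridly strongly universal, the same conclusion holds without the assumption that $P_s$ is not a monomial (i.e. for every $P_s\in\mathcal{D}_s[X]$ of degree greater than zero).
   Context: A general Dirichlet series is a series $\sum_{n=1}^\infty a_n e^{-\lambda_n s}$ with $a_n\in\mathbb{C}$, $\lambda_n\in\mathbb{R}$. $\mathcal{D}_s$ denotes the ring of all general Dirichlet series that are absolutely convergent in the half-plane $\Re(s)>1/2$, and $\mathcal{D}_s[X]$ the ring of polynomials in $X$ with coefficients in $\mathcal{D}_s$; for $P_s(X)=\sum_{k=0}^m c_k(s)X^k\in\mathcal{D}_s[X]$ we write $P_s(L(s))=\sum_{k=0}^m c_k(s)L(s)^k$. A monomial is a polynomial with exactly one nonzero coefficient. For $T>0$ and a condition on $\tau$, $\nu_T\{\cdots\}:=T^{-1}\mu\{\tau\in[0,T]:\cdots\}$, where $\mu$ is Lebesgue measure. For a compact $K\subset D$ with connected complement, $H_0(K)$ is the space of functions continuous on $K$ and analytic in its interior, with supremum norm $\|\cdot\|_K$, and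 $H(K)\subset H_0(K)$ the subset of functions that do not vanish on $K$. For real $x$, $\|x\|$ denotes the distance from $x$ to the nearest integer. $L(s)$ is called hybridly universal if: for every compact $K\subset D$ with connected complement, every $f\in H(K)$, every finite family $\alpha_1,\dots,\alpha_k$ of real numbers linearly independent over $\mathbb{Q}$, all real $\theta_1,\dots,\theta_k$ and every $\varepsilon>0$, $\liminf_{T\to\infty}\nu_T\{\|L(s+i\tau)-f(s)\|_K<\varepsilon,\ \|\tau\alpha_j-\theta_j\|<\varepsilon \ (1\le j\le k)\}>0$. It is called hybridly strongly universal if the same holds for every $f\in H_0(K)$.
   Formalization: L(s) is assumed analytic on D; for an arbitrary function the claim fails, e.g. changing zeta at its 1-points in D by nonzero amounts tending to 0 as |t| grows keeps hybrid universality but leaves X-1 without zeros. *)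

theory Defs
  imports
    "HOL-Analysis.Analysis"
    "HOL-Complex_Analysis.Complex_Analysis"
    "HOL-Computational_Algebra.Polynomial"
    "HOL-Library.Function_Algebras"
begin

definition strip :: "complex set" where
  "strip = {s. 1/2 < Re s \<and> Re s < 1}"

text \<open>
  The ring of general Dirichlet series that converge absolutely for Re s > 1/2, as a ring of
  functions under the pointwise operations. A series is identified with the function it defines
  on the half-plane; that function is extended by 0, so that the zero series is exactly the
  zero of the function ring and \<^const>\<open>degree\<close> has its usual meaning for polynomials
  over this ring. The frequencies are arbitrary reals: no monotonicity or
  distinctness is required.
\<close>
definition dirichlet_ring :: "(complex \<Rightarrow> complex) set" where
  "dirichlet_ring = {c.
     (\<exists>(a :: nat \<Rightarrow> complex) (l :: nat \<Rightarrow> real). \<forall>s. Re s > 1/2 \<longrightarrow>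
        summable (\<lambda>n. norm (a n * exp (- of_real (l n) * s))) \<and>
        c s = (\<Sum>n. a n * exp (- of_real (l n) * s))) \<and>
     (\<forall>s. Re s \<le> 1/2 \<longrightarrow> c s = 0)}"

definition dirichlet_polys :: "(complex \<Rightarrow> complex) poly set" where
  "dirichlet_polys = {P. \<forall>k. coeff P k \<in> dirichlet_ring}"

definition is_monomial :: "'a::zero poly \<Rightarrow> bool" where
  "is_monomial P \<longleftrightarrow> (\<exists>!k. coeff P k \<noteq> 0)"

definition eval_at_fun ::
  "(complex \<Rightarrow> complex) poly \<Rightarrow> (complex \<Rightarrow> complex) \<Rightarrow> complex \<Rightarrow> complex" where
  "eval_at_fun P L s = (\<Sum>k\<le>degree P. coeff P k s * L s ^ k)"

definition density_upto :: "real \<Rightarrow> (real \<Rightarrow> bool) \<Rightarrow> real" where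
  "density_upto T Q = measure lebesgue {\<tau> \<in> {0..T}. Q \<tau>} / T"

text \<open>The inserted 0 only matters for empty \<open>K\<close>, where the supremum would be unspecified.\<close>
definition sup_norm_on :: "complex set \<Rightarrow> (complex \<Rightarrow> complex) \<Rightarrow> real" where
  "sup_norm_on K g = Sup (insert 0 ((\<lambda>s. norm (g s)) ` K))"

definition H0 :: "complex set \<Rightarrow> (complex \<Rightarrow> complex) set" where
  "H0 K = {f. continuous_on K f \<and> f holomorphic_on interior K}"

definition H :: "complex set \<Rightarrow> (complex \<Rightarrow> complex) set" where
  "H K = {f \<in> H0 K. \<forall>s\<in>K. f s \<noteq> 0}"

definition dist_nearest_int :: "real \<Rightarrow> real" where
  "dist_nearest_int x = \<bar>x - of_int (round x)\<bar>"

text \<open>Injectivity is needed because \<^const>\<open>module.dependent\<close> speaks about sets, not families.\<close>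
definition rat_lin_indep :: "nat \<Rightarrow> (nat \<Rightarrow> real) \<Rightarrow> bool" where
  "rat_lin_indep k \<alpha> \<longleftrightarrow> inj_on \<alpha> {1..k} \<and>
     \<not> module.dependent (\<lambda>(q::rat) (x::real). of_rat q * x) (\<alpha> ` {1..k})"

definition hybrid_approx ::
  "(complex \<Rightarrow> complex) \<Rightarrow> complex set \<Rightarrow> (complex \<Rightarrow> complex) \<Rightarrow> bool" where
  "hybrid_approx L K f \<longleftrightarrow>
     (\<forall>(k::nat) (\<alpha> :: nat \<Rightarrow> real) (\<theta> :: nat \<Rightarrow> real) \<epsilon>.
        rat_lin_indep k \<alpha> \<and> \<epsilon> > 0 \<longrightarrow>
        Liminf at_top (\<lambda>T. ereal (density_upto T (\<lambda>\<tau>.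
            sup_norm_on K (\<lambda>s. L (s + \<i> * of_real \<tau>) - f s) < \<epsilon> \<and>
            (\<forall>j\<in>{1..k}. dist_nearest_int (\<tau> * \<alpha> j - \<theta> j) < \<epsilon>)))) > 0)"

definition hybridly_universal :: "(complex \<Rightarrow> complex) \<Rightarrow> bool" where
  "hybridly_universal L \<longleftrightarrow>
     (\<forall>K f. compact K \<and> K \<subseteq> strip \<and> connected (- K) \<and> f \<in> H K \<longrightarrow> hybrid_approx L K f)"

definition hybridly_strongly_universal :: "(complex \<Rightarrow> complex) \<Rightarrow> bool" where
  "hybridly_strongly_universal L \<longleftrightarrow>
     (\<forall>K f. compact K \<and> K \<subseteq> strip \<and> connected (- K) \<and> f \<in> H0 K \<longrightarrow> hybrid_approx L K f)"

text \<open>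
  Zeros are counted without multiplicity. Since \<^const>\<open>card\<close> of an infinite set is 0, the
  inequality below also says that there are only finitely many zeros in each rectangle.
\<close>
definition has_many_zeros :: "(complex \<Rightarrow> complex) \<Rightarrow> bool" where
  "has_many_zeros F \<longleftrightarrow>
     infinite {s \<in> strip. F s = 0} \<and>
     (\<forall>\<sigma>1 \<sigma>2. 1/2 < \<sigma>1 \<and> \<sigma>1 < \<sigma>2 \<and> \<sigma>2 < 1 \<longrightarrow>
        (\<exists>C>0. \<forall>\<^sub>F T in at_top.
           real (card {s. \<sigma>1 < Re s \<and> Re s < \<sigma>2 \<and> 0 < Im s \<and> Im s < T \<and> F s = 0}) > C * T))"

end

theory Submission
  imports Defs "HOL-Computational_Algebra.Fundamental_Theorem_Algebra"
begin

text \<open>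
  Fix \<open>s0\<close> at which the leading coefficient does not vanish and a root \<open>w\<close> of \<open>P\<^sub>s\<^sub>0\<close>; if \<open>P\<close> is not a
  monomial, \<open>w\<close> can be chosen nonzero. Take \<open>f\<close> with \<open>f s0 = w\<close> on a small disc around \<open>s0\<close>.
  The coefficients of \<open>P\<close> are almost periodic under vertical shifts: a shift by \<open>\<tau>\<close> changes them
  little once finitely many \<open>\<tau> \<alpha>\<^sub>j\<close> are close to integers, with \<open>\<alpha>\<^sub>j\<close> independent over the
  rationals. Hybrid universality supplies a set of such \<open>\<tau>\<close> of positive lower density for which,
  in addition, \<open>L\<close> shifted by \<open>\<tau>\<close> is close to \<open>f\<close>. For these \<open>\<tau>\<close> the function \<open>P\<^sub>s(L(s))\<close> is small
  at \<open>s0 + i \<tau>\<close> and bounded below on the boundary of the shifted disc, hence has a zero inside.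
  One zero serves only a \<open>\<tau>\<close>-interval of the length of the diameter, so positive density gives
  linearly many zeros.
\<close>

subsection \<open>Distance to the nearest integer\<close>

lemma dist_nearest_int_le: "dist_nearest_int x \<le> \<bar>x - of_int m\<bar>"
  unfolding dist_nearest_int_def by (rule round_diff_minimal)

text \<open>Replacing every \<open>y i\<close> by its nearest integer turns the combination into an
  integer, and the distance to that integer is estimated term by term.\<close>

lemma dist_nearest_int_sum_le:
  fixes m :: "'a \<Rightarrow> int"
  shows "dist_nearest_int (\<Sum>i\<in>I. of_int (m i) * y i)
    \<le> (\<Sum>i\<in>I. \<bar>of_int (m i)\<bar> * dist_nearest_int (y i))"
proof -
  have "dist_nearest_int (\<Sum>i\<in>I. of_int (m i) * y i)
      \<le> \<bar>(\<Sum>i\<in>I. of_int (m i) * y i) - of_int (\<Sum>i\<in>I. m i * round (y i))\<bar>"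
    by (rule dist_nearest_int_le)
  also have "\<dots> = \<bar>\<Sum>i\<in>I. of_int (m i) * (y i - of_int (round (y i)))\<bar>"
    by (simp add: right_diff_distrib sum_subtractf)
  also have "\<dots> \<le> (\<Sum>i\<in>I. \<bar>of_int (m i) * (y i - of_int (round (y i)))\<bar>)"
    by (rule sum_abs)
  finally show ?thesis by (simp add: abs_mult dist_nearest_int_def)
qed

text \<open>Subtracting the nearest integer from \<open>x\<close> changes the angle by full turns
  only, and the chord of the remaining angle is at most its arc. This translates Diophantine
  conditions on \<open>\<tau>\<close> into bounds on the terms of a Dirichlet series.\<close>

lemma norm_exp_minus_1_le_dist_nearest_int:
  "norm (exp (\<i> * of_real (2 * pi * x)) - 1) \<le> 2 * pi * dist_nearest_int x"
proof -
  define y where "y = x - of_int (round x)"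
  have "exp (\<i> * of_real (2 * pi * x)) = exp (\<i> * of_real (2 * pi * y))"
    unfolding y_def exp_eq by (intro exI[of _ "round x"]) (simp add: algebra_simps)
  then have "norm (exp (\<i> * of_real (2 * pi * x)) - 1) = 2 * \<bar>sin (pi * y)\<bar>"
    by (simp only: dist_exp_i_1) simp
  also have "\<dots> \<le> 2 * \<bar>pi * y\<bar>"
    using abs_sin_x_le_abs_x[of "pi * y"] by simp
  finally show ?thesis
    by (simp add: y_def dist_nearest_int_def abs_mult)
qed

section \<open>Integer combinations of rationally independent frequencies\<close>

lemma common_denominator:
  assumes "finite (Q :: rat set)"
  shows "\<exists>N::nat. N > 0 \<and> (\<forall>q\<in>Q. \<exists>z::int. of_nat N * q = of_int z)"
  using assms
proof induction
  case empty
  show ?case by (rule exI[of _ 1]) simp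
next
  case (insert q Q)
  then obtain N :: nat where N: "N > 0" "\<forall>q\<in>Q. \<exists>z::int. of_nat N * q = of_int z" by blast
  obtain a b where ab: "q = of_int a / of_int b" "(b::int) > 0"
    by (metis quotient_of_denom_pos quotient_of_div surj_pair)
  have bn: "of_nat (nat b) = (of_int b :: rat)" using ab by simp
  have "\<exists>z::int. of_nat (N * nat b) * r = of_int z" if "r \<in> insert q Q" for r
  proof (cases "r = q")
    case True
    have "of_nat (N * nat b) * r = of_int (int N * a)"
      unfolding True of_nat_mult bn using ab by simp
    then show ?thesis by blast
  next
    case False
    then have "r \<in> Q" using that by simp
    with N(2) have "\<exists>z::int. of_nat N * r = of_int z" by (rule bspec)
    then obtain z :: int where z: "of_nat N * r = of_int z" by (rule exE)
    have "of_nat (N * nat b) * r = of_int (b * z)"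
      unfolding of_nat_mult bn of_int_mult z[symmetric] by simp
    then show ?thesis by blast
  qed
  moreover have "N * nat b > 0" using N ab by simp
  ultimately show ?case by blast
qed

lemma vector_space_rat_real: "vector_space (\<lambda>(q::rat) (x::real). of_rat q * x)"
  by unfold_locales (simp_all add: algebra_simps of_rat_add of_rat_mult)

text \<open>A rational basis of the span of the given frequencies, divided by a common
  denominator, has every frequency as an integer combination.\<close>
lemma integer_basis:
  assumes fin: "finite (\<Lambda> :: real set)"
  shows "\<exists>k \<alpha>. rat_lin_indep k \<alpha> \<and>
     (\<forall>l\<in>\<Lambda>. \<exists>m :: nat \<Rightarrow> int. l = (\<Sum>j\<in>{1..k}. of_int (m j) * \<alpha> j))"
proof -
  interpret vs: vector_space "\<lambda>(q::rat) (x::real). of_rat q * x"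
    by (rule vector_space_rat_real)
  obtain B where B: "B \<subseteq> \<Lambda>" "vs.independent B" "\<Lambda> \<subseteq> vs.span B"
    by (rule vs.maximal_independent_subset)
  have finB: "finite B" using B fin finite_subset by blast
  have "\<forall>l\<in>\<Lambda>. \<exists>u. l = (\<Sum>v\<in>B. of_rat (u v) * v)"
    using B(3) vs.span_finite[OF finB] by auto
  then obtain u where u: "\<And>l. l \<in> \<Lambda> \<Longrightarrow> l = (\<Sum>v\<in>B. of_rat (u l v) * v)" by metis
  have "finite ((\<lambda>(l,v). u l v) ` (\<Lambda> \<times> B))" using fin finB by simp
  from common_denominator[OF this] obtain N :: nat where
    N: "N > 0" "\<forall>q\<in>(\<lambda>(l,v). u l v) ` (\<Lambda> \<times> B). \<exists>z::int. of_nat N * q = of_int z" by blast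
  then have "\<forall>l\<in>\<Lambda>. \<forall>v\<in>B. \<exists>z::int. of_nat N * u l v = of_int z" by auto
  then obtain z :: "real \<Rightarrow> real \<Rightarrow> int" where
    z: "\<And>l v. l \<in> \<Lambda> \<Longrightarrow> v \<in> B \<Longrightarrow> of_nat N * u l v = of_int (z l v)" by metis
  have zr: "of_rat (u l v) = (of_int (z l v) / of_nat N :: real)" if "l \<in> \<Lambda>" "v \<in> B" for l v
  proof -
    have "of_rat (of_nat N * u l v) = (of_int (z l v) :: real)" using z[OF that] by simp
    then show ?thesis using N(1) by (simp add: of_rat_mult field_simps)
  qed
  obtain b where b: "bij_betw b {1..card B} B"
    using finB by (metis ex_bij_betw_nat_finite_1)
  define \<alpha> where "\<alpha> j = b j / of_nat N" for j
  have inj: "inj_on \<alpha> {1..card B}"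
  proof (rule inj_onI)
    fix i j assume ij: "i \<in> {1..card B}" "j \<in> {1..card B}" "\<alpha> i = \<alpha> j"
    then have "b i = b j" using N(1) by (simp add: \<alpha>_def)
    from inj_onD[OF bij_betw_imp_inj_on[OF b] this ij(1,2)] show "i = j" .
  qed
  have "vs.independent (\<alpha> ` {1..card B})"
  proof
    \<comment> \<open>A relation among the rescaled elements becomes, after multiplication by
      \<open>N\<close>, a relation among the elements of \<open>B\<close> with the same
      coefficients.\<close>
    assume "vs.dependent (\<alpha> ` {1..card B})"
    then obtain w where w: "\<exists>v\<in>\<alpha> ` {1..card B}. w v \<noteq> 0"
      "(\<Sum>v\<in>\<alpha> ` {1..card B}. of_rat (w v) * v) = 0"
      using vs.dependent_finite[of "\<alpha> ` {1..card B}"] by (simp only: finite_imageI finite_atLeastAtMost simp_thms) (elim exE conjE)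
    have "\<alpha> ` {1..card B} = (\<lambda>v. v / of_nat N) ` b ` {1..card B}"
      by (simp add: \<alpha>_def image_image)
    then have im: "\<alpha> ` {1..card B} = (\<lambda>v. v / of_nat N) ` B"
      by (simp only: bij_betw_imp_surj_on[OF b])
    have injN: "inj_on (\<lambda>v::real. v / of_nat N) B" using N(1) by (intro inj_onI) simp
    have "(\<Sum>v\<in>B. of_rat (w (v / of_nat N)) * (v / of_nat N)) = 0"
      using w(2) unfolding im sum.reindex[OF injN] by simp
    then have "(\<Sum>v\<in>B. of_rat (w (v / of_nat N)) * v) = 0"
      using N(1) by (simp add: sum_divide_distrib[symmetric])
    moreover have "\<exists>v\<in>B. w (v / of_nat N) \<noteq> 0" using w(1) unfolding im by blast
    ultimately have "vs.dependent B"
      unfolding vs.dependent_finite[OF finB] by (intro exI[of _ "\<lambda>v. w (v / of_nat N)"]) blast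
    with B(2) show False by blast
  qed
  then have "rat_lin_indep (card B) \<alpha>" using inj by (simp add: rat_lin_indep_def)
  moreover have "\<exists>m :: nat \<Rightarrow> int. l = (\<Sum>j\<in>{1..card B}. of_int (m j) * \<alpha> j)" if l: "l \<in> \<Lambda>" for l
  proof -
    have "l = (\<Sum>v\<in>B. of_int (z l v) / of_nat N * v)"
      using u[OF l] zr[OF l] by simp
    also have "\<dots> = (\<Sum>j\<in>{1..card B}. of_int (z l (b j)) / of_nat N * b j)"
      by (rule sum.reindex_bij_betw[OF b, symmetric])
    also have "\<dots> = (\<Sum>j\<in>{1..card B}. of_int (z l (b j)) * \<alpha> j)"
      by (simp add: \<alpha>_def)
    finally show ?thesis by (rule exI[of _ "\<lambda>j. z l (b j)"])
  qed
  ultimately show ?thesis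
    by (intro exI[of _ "card B"] exI[of _ \<alpha>] conjI ballI)
qed

text \<open>Hybrid universality controls \<open>\<tau> * \<alpha> j\<close> only for independent
  \<open>\<alpha> j\<close>, whereas the frequencies of a Dirichlet series may be dependent. Integer
  combinations of near-integers are again near-integers, with the error enlarged by at most the sum
  of the absolute coefficients.\<close>

lemma independent_frequencies:
  assumes fin: "finite (\<Lambda> :: real set)" and "\<delta> > 0"
  shows "\<exists>k \<alpha> \<delta>'. rat_lin_indep k \<alpha> \<and> \<delta>' > 0 \<and>
     (\<forall>\<tau>. (\<forall>j\<in>{1..k}. dist_nearest_int (\<tau> * \<alpha> j) < \<delta>') \<longrightarrow>
        (\<forall>l\<in>\<Lambda>. dist_nearest_int (\<tau> * l) < \<delta>))"
proof -
  obtain k \<alpha> where ind: "rat_lin_indep k \<alpha>"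
    and ex: "\<forall>l\<in>\<Lambda>. \<exists>m :: nat \<Rightarrow> int. l = (\<Sum>j\<in>{1..k}. of_int (m j) * \<alpha> j)"
    using integer_basis[OF fin] by blast
  obtain m :: "real \<Rightarrow> nat \<Rightarrow> int" where
    m: "\<And>l. l \<in> \<Lambda> \<Longrightarrow> l = (\<Sum>j\<in>{1..k}. of_int (m l j) * \<alpha> j)"
    using bchoice[OF ex] by blast
  \<comment> \<open>The total over all of \<open>\<Lambda>\<close> serves every frequency at once;
    the summand 1 allows division by \<open>M\<close> and gives the strict inequality below.\<close>
  define M :: real where "M = 1 + (\<Sum>l\<in>\<Lambda>. \<Sum>j\<in>{1..k}. \<bar>of_int (m l j)\<bar>)"
  have M: "M \<ge> 1" unfolding M_def by (simp add: sum_nonneg)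
  define \<delta>' where "\<delta>' = \<delta> / M"
  have d': "\<delta>' > 0" using M \<open>\<delta> > 0\<close> by (simp add: \<delta>'_def)
  have "dist_nearest_int (\<tau> * l) < \<delta>"
    if \<tau>: "\<forall>j\<in>{1..k}. dist_nearest_int (\<tau> * \<alpha> j) < \<delta>'" and l: "l \<in> \<Lambda>" for \<tau> l
  proof -
    have "\<tau> * l = (\<Sum>j\<in>{1..k}. of_int (m l j) * (\<tau> * \<alpha> j))"
      by (subst m[OF l]) (simp add: sum_distrib_left mult_ac)
    then have "dist_nearest_int (\<tau> * l) \<le> (\<Sum>j\<in>{1..k}. \<bar>of_int (m l j)\<bar> * dist_nearest_int (\<tau> * \<alpha> j))"
      by (simp only: dist_nearest_int_sum_le)
    also have "\<dots> \<le> (\<Sum>j\<in>{1..k}. \<bar>of_int (m l j)\<bar> * \<delta>')"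
      using \<tau> by (intro sum_mono mult_left_mono) (auto intro: less_imp_le)
    also have "\<dots> = (\<Sum>j\<in>{1..k}. \<bar>of_int (m l j)\<bar>) * \<delta>'"
      by (simp add: sum_distrib_right)
    also have "\<dots> < M * \<delta>'"
    proof (rule mult_strict_right_mono[OF _ d'])
      have "(\<Sum>j\<in>{1..k}. \<bar>of_int (m l j)\<bar>) \<le> (\<Sum>l\<in>\<Lambda>. \<Sum>j\<in>{1..k}. \<bar>of_int (m l j)\<bar> :: real)"
        using fin l by (intro member_le_sum) (auto intro: sum_nonneg)
      then show "(\<Sum>j\<in>{1..k}. \<bar>of_int (m l j)\<bar>) < M" unfolding M_def by linarith
    qed
    also have "\<dots> = \<delta>" using M by (simp add: \<delta>'_def)
    finally show ?thesis .
  qed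
  then show ?thesis using ind d' by blast
qed

subsection \<open>General Dirichlet series\<close>

text \<open>Each term has a modulus monotone in \<open>Re s\<close>, in a direction that depends on
  the sign of \<open>l n\<close>. Its maximum on the closed strip is therefore attained at one of
  the edges, and the sum of both edge values covers either sign.\<close>

lemma dirichlet_uniform_majorant:
  assumes conv: "\<And>s. Re s > 1/2 \<Longrightarrow> summable (\<lambda>n. norm (a n * exp (- of_real (l n) * s)))"
    and "\<sigma>1 > 1/2" "\<sigma>1 \<le> \<sigma>2"
  obtains M :: "nat \<Rightarrow> real" where "summable M" and
    "\<And>n s. \<sigma>1 \<le> Re s \<Longrightarrow> Re s \<le> \<sigma>2 \<Longrightarrow> norm (a n * exp (- of_real (l n) * s)) \<le> M n"
proof
  let ?M = "\<lambda>n. norm (a n * exp (- of_real (l n) * of_real \<sigma>1)) + norm (a n * exp (- of_real (l n) * of_real \<sigma>2))"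
  show "summable ?M"
    using assms by (intro summable_add conv) auto
  show "norm (a n * exp (- of_real (l n) * s)) \<le> ?M n" if "\<sigma>1 \<le> Re s" "Re s \<le> \<sigma>2" for n s
  proof -
    have "exp (- (l n * Re s)) \<le> exp (- (l n * \<sigma>1)) + exp (- (l n * \<sigma>2))"
    proof (cases "l n \<ge> 0")
      case True
      then have "exp (- (l n * Re s)) \<le> exp (- (l n * \<sigma>1))" using that by (simp add: mult_left_mono)
      then show ?thesis using exp_gt_zero[of "- (l n * \<sigma>2)"] by linarith
    next
      case False
      then have "exp (- (l n * Re s)) \<le> exp (- (l n * \<sigma>2))" using that by (simp add: mult_left_mono_neg)
      then show ?thesis using exp_gt_zero[of "- (l n * \<sigma>1)"] by linarith
    qed
    from mult_left_mono[OF this norm_ge_zero[of "a n"]]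
    show ?thesis by (simp add: norm_mult distrib_left)
  qed
qed

lemma dirichlet_ring_expansion:
  assumes "c \<in> dirichlet_ring"
  shows "\<exists>a l. \<forall>s. Re s > 1/2 \<longrightarrow> summable (\<lambda>n. norm (a n * exp (- of_real (l n) * s))) \<and>
      c s = (\<Sum>n. a n * exp (- of_real (l n) * s))"
  using assms unfolding dirichlet_ring_def mem_Collect_eq by (rule conjunct1)

lemma dirichlet_ring_holomorphic:
  assumes "c \<in> dirichlet_ring"
  shows "c holomorphic_on {s. 1/2 < Re s}"
proof -
  obtain a l where exp: "\<forall>s. Re s > 1/2 \<longrightarrow> summable (\<lambda>n. norm (a n * exp (- of_real (l n) * s))) \<and>
      c s = (\<Sum>n. a n * exp (- of_real (l n) * s))"
    using dirichlet_ring_expansion[OF assms(1)] by blast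
  then have al: "\<And>s. Re s > 1/2 \<Longrightarrow> summable (\<lambda>n. norm (a n * exp (- of_real (l n) * s)))"
    "\<And>s. Re s > 1/2 \<Longrightarrow> c s = (\<Sum>n. a n * exp (- of_real (l n) * s))"
    by (simp_all only: simp_thms)
  let ?f = "\<lambda>N s. \<Sum>n<N. a n * exp (- of_real (l n) * s)"
  show ?thesis
  proof (rule holomorphic_uniform_sequence[where f = ?f])
    show "open {s. 1/2 < Re s}" by (rule open_halfspace_Re_gt)
    show "?f N holomorphic_on {s. 1/2 < Re s}" for N by (intro holomorphic_intros)
    fix x assume "x \<in> {s. 1/2 < Re s}"
    then have x: "1/2 < Re x" by simp
    \<comment> \<open>Half the distance to the line \<open>Re s = 1/2\<close>, so that the closed
      disc stays inside the half-plane and the majorant gives uniform convergence on it.\<close>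
    define d where "d = (Re x - 1/2) / 2"
    have d: "d > 0" "Re x - d > 1/2" using x by (auto simp: d_def field_simps)
    have re: "Re x - d \<le> Re s \<and> Re s \<le> Re x + d" if "s \<in> cball x d" for s
    proof -
      have "\<bar>Re (x - s)\<bar> \<le> d" using that abs_Re_le_cmod[of "x - s"] by (simp add: dist_norm)
      then show ?thesis by (simp add: abs_le_iff)
    qed
    obtain M where M: "summable M" "\<And>n s. Re x - d \<le> Re s \<Longrightarrow> Re s \<le> Re x + d \<Longrightarrow>
        norm (a n * exp (- of_real (l n) * s)) \<le> M n"
      using dirichlet_uniform_majorant[of a l "Re x - d" "Re x + d"] al(1) d by auto
    have "uniform_limit (cball x d) ?f (\<lambda>s. \<Sum>n. a n * exp (- of_real (l n) * s)) sequentially"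
      by (rule Weierstrass_m_test[OF _ M(1)]) (use re M(2) in blast)
    then have "uniform_limit (cball x d) ?f c sequentially"
      by (rule uniform_limit_cong'[THEN iffD1, rotated 2]) (use re d in \<open>force simp: al(2)\<close>)+
    moreover have "cball x d \<subseteq> {s. 1/2 < Re s}" using re d by force
    ultimately show "\<exists>d. 0 < d \<and> cball x d \<subseteq> {s. 1/2 < Re s} \<and> uniform_limit (cball x d) ?f c sequentially"
      using d(1) by blast
  qed
qed

text \<open>A vertical shift multiplies the n-th term by \<open>exp (- \<i> * l n * \<tau>)\<close>.
  The tail is small uniformly by the majorant, whatever \<open>\<tau>\<close> is; in the finite head
  these factors are near 1 once \<open>\<tau> * l n / (2 * pi)\<close> is near an integer.\<close>

lemma dirichlet_ring_almost_periodic: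
  assumes "c \<in> dirichlet_ring" "\<sigma>1 > 1/2" "\<sigma>1 \<le> \<sigma>2" "\<epsilon> > 0"
  shows "\<exists>\<Lambda> \<delta>. finite \<Lambda> \<and> \<delta> > 0 \<and>
    (\<forall>\<tau>. (\<forall>l\<in>\<Lambda>. dist_nearest_int (\<tau> * l) < \<delta>) \<longrightarrow>
      (\<forall>s. \<sigma>1 \<le> Re s \<and> Re s \<le> \<sigma>2 \<longrightarrow> norm (c (s + \<i> * of_real \<tau>) - c s) < \<epsilon>))"
proof -
  obtain a l where exp: "\<forall>s. Re s > 1/2 \<longrightarrow> summable (\<lambda>n. norm (a n * exp (- of_real (l n) * s))) \<and>
      c s = (\<Sum>n. a n * exp (- of_real (l n) * s))"
    using dirichlet_ring_expansion[OF assms(1)] by blast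
  then have al: "\<And>s. Re s > 1/2 \<Longrightarrow> summable (\<lambda>n. norm (a n * exp (- of_real (l n) * s)))"
    "\<And>s. Re s > 1/2 \<Longrightarrow> c s = (\<Sum>n. a n * exp (- of_real (l n) * s))"
    by (simp_all only: simp_thms)
  define e where "e n s = a n * exp (- of_real (l n) * s)" for n s
  obtain M where M: "summable M" "\<And>n s. \<sigma>1 \<le> Re s \<Longrightarrow> Re s \<le> \<sigma>2 \<Longrightarrow> norm (e n s) \<le> M n"
    using dirichlet_uniform_majorant[OF al(1) assms(2,3)] unfolding e_def by auto
  have sume: "summable (\<lambda>n. norm (e n s))" if "Re s > 1/2" for s
    using al(1)[OF that] by (simp add: e_def)
  have M0: "M n \<ge> 0" for n
    using M(2)[of "of_real \<sigma>1" n] assms(3) norm_ge_zero order_trans by (metis Re_complex_of_real order_refl)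
  \<comment> \<open>Shifted and unshifted tails each contribute, so a quarter of
    \<open>\<epsilon>\<close> leaves the other half for the head.\<close>
  obtain N where N: "(\<Sum>n. M (n + N)) < \<epsilon> / 4"
  proof -
    have "\<exists>N. \<forall>n\<ge>N. norm (\<Sum>i. M (i + n)) < \<epsilon> / 4"
      using suminf_exist_split[OF _ M(1), of "\<epsilon> / 4"] assms(4) by simp
    then obtain N where "norm (\<Sum>i. M (i + N)) < \<epsilon> / 4" by blast
    then have "(\<Sum>i. M (i + N)) < \<epsilon> / 4" by (simp add: abs_less_iff)
    then show ?thesis using that by blast
  qed
  define S where "S = 1 + (\<Sum>n<N. M n)"
  have S: "S \<ge> 1" unfolding S_def using M0 by (simp add: sum_nonneg)
  \<comment> \<open>Chosen so that the head, at most \<open>S * (2 * pi * \<delta>)\<close>, costs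
    no more than \<open>\<epsilon> / 2\<close>.\<close>
  define \<delta> where "\<delta> = \<epsilon> / (4 * pi * S)"
  have d: "\<delta> > 0" using S assms(4) by (simp add: \<delta>_def)
  define \<Lambda> where "\<Lambda> = (\<lambda>n. - l n / (2 * pi)) ` {..<N}"
  have "norm (c (s + \<i> * of_real \<tau>) - c s) < \<epsilon>"
    if \<tau>: "\<forall>l\<in>\<Lambda>. dist_nearest_int (\<tau> * l) < \<delta>" and s: "\<sigma>1 \<le> Re s" "Re s \<le> \<sigma>2" for \<tau> s
  proof -
    define g where "g n = e n (s + \<i> * of_real \<tau>) - e n s" for n
    have gM: "norm (g n) \<le> 2 * M n" for n
      unfolding g_def using M(2)[of "s + \<i> * of_real \<tau>" n] M(2)[of s n] s
      norm_triangle_ineq4[of "e n (s + \<i> * of_real \<tau>)" "e n s"] by simp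
    have sg: "summable (\<lambda>n. norm (g n))"
      by (rule summable_comparison_test'[where N = 0, OF summable_mult[OF M(1), of 2]]) (use gM in auto)
    have "summable (\<lambda>n. e n (s + \<i> * of_real \<tau>))" "summable (\<lambda>n. e n s)"
      using s assms(2) by (intro summable_norm_cancel[OF sume]; simp)+
    then have "c (s + \<i> * of_real \<tau>) - c s = suminf g"
      unfolding g_def using s assms(2) by (subst suminf_diff[symmetric]) (auto simp: al(2) e_def)
    also have "norm \<dots> \<le> (\<Sum>n. norm (g n))" by (rule summable_norm[OF sg])
    also have "\<dots> = (\<Sum>n. norm (g (n + N))) + (\<Sum>n<N. norm (g n))"
      by (rule suminf_split_initial_segment[OF sg])
    also have "(\<Sum>n. norm (g (n + N))) \<le> (\<Sum>n. 2 * M (n + N))"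
    proof (rule suminf_le)
      show "summable (\<lambda>n. norm (g (n + N)))" using sg by (rule summable_ignore_initial_segment)
      show "summable (\<lambda>n. 2 * M (n + N))"
        using M(1) by (intro summable_mult summable_ignore_initial_segment)
    qed (rule gM)
    also have "\<dots> = 2 * (\<Sum>n. M (n + N))"
      using M(1) by (intro suminf_mult summable_ignore_initial_segment)
    also have "\<dots> < \<epsilon> / 2" using N by simp
    also have "(\<Sum>n<N. norm (g n)) \<le> (\<Sum>n<N. M n * (2 * pi * \<delta>))"
    proof (rule sum_mono)
      fix n assume n: "n \<in> {..<N}"
      have "g n = e n s * (exp (\<i> * of_real (2 * pi * (\<tau> * (- l n / (2 * pi))))) - 1)"
        unfolding g_def e_def by (simp add: algebra_simps exp_add[symmetric])
      then have "norm (g n) = norm (e n s) * norm (exp (\<i> * of_real (2 * pi * (\<tau> * (- l n / (2 * pi))))) - 1)"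
        by (simp only: norm_mult)
      also have "\<dots> \<le> M n * (2 * pi * \<delta>)"
      proof (rule mult_mono[OF M(2)[OF s] _ M0 norm_ge_zero])
        have "- l n / (2 * pi) \<in> \<Lambda>" unfolding \<Lambda>_def using n by (rule imageI)
        with \<tau> have "dist_nearest_int (\<tau> * (- l n / (2 * pi))) \<le> \<delta>" by (intro less_imp_le) (rule bspec)
        then show "norm (exp (\<i> * of_real (2 * pi * (\<tau> * (- l n / (2 * pi))))) - 1) \<le> 2 * pi * \<delta>"
          by (intro order_trans[OF norm_exp_minus_1_le_dist_nearest_int]) simp
      qed
      finally show "norm (g n) \<le> M n * (2 * pi * \<delta>)" .
    qed
    also have "(\<Sum>n<N. M n * (2 * pi * \<delta>)) = (S - 1) * (2 * pi * \<delta>)"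
      by (simp add: S_def sum_distrib_right)
    also have "\<dots> \<le> S * (2 * pi * \<delta>)" using d by (intro mult_right_mono) auto
    also have "\<dots> = \<epsilon> / 2" using S by (simp add: \<delta>_def field_simps)
    finally show ?thesis by simp
  qed
  moreover have "finite \<Lambda>" by (simp add: \<Lambda>_def)
  ultimately show ?thesis using d by blast
qed

text \<open>One system of independent frequencies serves all coefficients: the frequency sets are
  united and the smallest tolerance is taken.\<close>

lemma dirichlet_ring_family_almost_periodic:
  assumes c: "\<And>k. k \<in> I \<Longrightarrow> c k \<in> dirichlet_ring" and "finite I"
    and "\<sigma>1 > 1/2" "\<sigma>1 \<le> \<sigma>2" "\<epsilon> > 0"
  shows "\<exists>n \<alpha> \<delta>. rat_lin_indep n \<alpha> \<and> \<delta> > 0 \<and>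
    (\<forall>\<tau>. (\<forall>j\<in>{1..n}. dist_nearest_int (\<tau> * \<alpha> j) < \<delta>) \<longrightarrow>
      (\<forall>k\<in>I. \<forall>s. \<sigma>1 \<le> Re s \<and> Re s \<le> \<sigma>2 \<longrightarrow> norm (c k (s + \<i> * of_real \<tau>) - c k s) < \<epsilon>))"
proof -
  have "\<forall>k\<in>I. \<exists>\<Lambda> \<delta>. finite \<Lambda> \<and> \<delta> > 0 \<and>
    (\<forall>\<tau>. (\<forall>l\<in>\<Lambda>. dist_nearest_int (\<tau> * l) < \<delta>) \<longrightarrow>
      (\<forall>s. \<sigma>1 \<le> Re s \<and> Re s \<le> \<sigma>2 \<longrightarrow> norm (c k (s + \<i> * of_real \<tau>) - c k s) < \<epsilon>))"
    using dirichlet_ring_almost_periodic[OF c assms(3-5)] by blast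
  then obtain \<Lambda> \<delta> where L: "\<And>k. k \<in> I \<Longrightarrow> finite (\<Lambda> k)" "\<And>k. k \<in> I \<Longrightarrow> \<delta> k > 0"
    "\<And>k \<tau> s. k \<in> I \<Longrightarrow> \<forall>l\<in>\<Lambda> k. dist_nearest_int (\<tau> * l) < \<delta> k \<Longrightarrow> \<sigma>1 \<le> Re s \<Longrightarrow> Re s \<le> \<sigma>2
      \<Longrightarrow> norm (c k (s + \<i> * of_real \<tau>) - c k s) < \<epsilon>"
    by metis
  \<comment> \<open>The inserted 1 covers an empty \<open>I\<close>.\<close>
  define d where "d = Min (insert 1 (\<delta> ` I))"
  have d: "d > 0" "\<And>k. k \<in> I \<Longrightarrow> d \<le> \<delta> k"
    using \<open>finite I\<close> L(2) by (auto simp: d_def)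
  have "finite (\<Union>k\<in>I. \<Lambda> k)" using L(1) \<open>finite I\<close> by blast
  from independent_frequencies[OF this d(1)] obtain n \<alpha> \<delta>' where
    *: "rat_lin_indep n \<alpha>" "\<delta>' > 0"
    "\<forall>\<tau>. (\<forall>j\<in>{1..n}. dist_nearest_int (\<tau> * \<alpha> j) < \<delta>') \<longrightarrow> (\<forall>l\<in>(\<Union>k\<in>I. \<Lambda> k). dist_nearest_int (\<tau> * l) < d)"
    by (elim exE conjE)
  have "norm (c k (s + \<i> * of_real \<tau>) - c k s) < \<epsilon>"
    if "\<forall>j\<in>{1..n}. dist_nearest_int (\<tau> * \<alpha> j) < \<delta>'" "k \<in> I" "\<sigma>1 \<le> Re s" "Re s \<le> \<sigma>2" for \<tau> k s
  proof (rule L(3)[OF that(2) _ that(3,4)], rule ballI)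
    fix l assume "l \<in> \<Lambda> k"
    then have "dist_nearest_int (\<tau> * l) < d" using *(3)[rule_format, OF that(1)[rule_format]] that(2) by blast
    then show "dist_nearest_int (\<tau> * l) < \<delta> k" using d(2)[OF that(2)] by simp
  qed
  then show ?thesis using *(1,2) by blast
qed

subsection \<open>Polynomials over the ring of Dirichlet series\<close>

text \<open>Specialising the coefficients at \<open>s\<close> can lower the degree, but the extra
  terms of the sum are then 0. Roots of ordinary complex polynomials thus become available
  pointwise.\<close>

lemma eval_at_fun_conv_poly: "eval_at_fun P g s = poly (map_poly (\<lambda>c. c s) P) (g s)"
proof -
  have "poly (map_poly (\<lambda>c. c s) P) (g s)
      = (\<Sum>k\<le>degree (map_poly (\<lambda>c. c s) P). coeff (map_poly (\<lambda>c. c s) P) k * g s ^ k)"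
    by (rule poly_altdef)
  also have "\<dots> = (\<Sum>k\<le>degree P. coeff (map_poly (\<lambda>c. c s) P) k * g s ^ k)"
    by (rule sum.mono_neutral_left) (auto simp: coeff_eq_0 not_le intro: order_trans[OF _ map_poly_degree_leq])
  finally show ?thesis by (simp add: eval_at_fun_def coeff_map_poly)
qed

lemma eval_at_fun_holomorphic:
  assumes "P \<in> dirichlet_polys" "g holomorphic_on S" "S \<subseteq> {s. 1/2 < Re s}"
  shows "eval_at_fun P g holomorphic_on S"
proof -
  have "coeff P k holomorphic_on S" for k
    using assms(1) holomorphic_on_subset[OF dirichlet_ring_holomorphic assms(3)]
    by (simp add: dirichlet_polys_def)
  then have "(\<lambda>s. \<Sum>k\<le>degree P. coeff P k s * g s ^ k) holomorphic_on S"
    using assms(2) by (intro holomorphic_intros) auto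
  then show ?thesis by (simp add: eval_at_fun_def[abs_def])
qed

text \<open>After the full power of the variable is split off, the cofactor \<open>q\<close> does
  not vanish at 0. Two nonzero coefficients prevent \<open>q\<close> from being constant, so any
  root of \<open>q\<close> will do.\<close>

lemma poly_nonzero_root:
  fixes p :: "complex poly"
  assumes "coeff p m \<noteq> 0" "coeff p n \<noteq> 0" "m \<noteq> n"
  obtains w where "w \<noteq> 0" "poly p w = 0"
proof -
  have "p \<noteq> 0" using assms by auto
  from order_decomp[OF this, of 0] obtain q where
    q: "p = [:- 0, 1:] ^ order 0 p * q" "\<not> [:- 0, 1:] dvd q" by blast
  have pq: "p = monom 1 (order 0 p) * q" using q(1) by (simp add: monom_altdef)
  have q0: "poly q 0 \<noteq> 0" using q(2) by (simp add: poly_eq_0_iff_dvd)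
  have "degree q \<noteq> 0"
  proof
    assume "degree q = 0"
    then obtain a where "q = [:a:]" by (rule degree_eq_zeroE)
    then have "coeff p k = 0" if "k \<noteq> order 0 p" for k
      by (subst pq) (use that in \<open>simp add: coeff_monom_mult coeff_pCons split: nat.split\<close>)
    then show False using assms by metis
  qed
  then obtain w where "poly q w = 0"
    using Fundamental_Theorem_Algebra.fundamental_theorem_of_algebra[of q] by (auto simp: constant_degree)
  with q0 pq that show thesis by (metis mult_zero_right poly_mult)
qed

text \<open>Each summand is uniformly continuous on a compact product of discs, and each of the
  \<open>n + 1\<close> summands is allowed an equal share of \<open>\<eta>\<close>. Radius
  \<open>M + 1\<close> leaves room for the perturbed arguments.\<close>

lemma power_sum_uniformly_continuous:
  fixes M \<eta> :: real
  assumes "\<eta> > 0"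
  obtains \<epsilon> where "\<epsilon> > 0" and
    "\<And>x y (u::complex) v. (\<And>k. k \<le> n \<Longrightarrow> norm (x k) \<le> M \<and> norm (y k - x k) < \<epsilon>) \<Longrightarrow> norm u \<le> M \<Longrightarrow>
       norm (v - u) < \<epsilon> \<Longrightarrow> norm ((\<Sum>k\<le>n. y k * v ^ k) - (\<Sum>k\<le>n. x k * u ^ k)) < \<eta>"
proof -
  let ?B = "cball (0::complex) (M + 1) \<times> cball (0::complex) (M + 1)"
  define \<eta>' where "\<eta>' = \<eta> / (real n + 1)"
  have \<eta>': "\<eta>' > 0" using assms by (simp add: \<eta>'_def)
  have "\<exists>\<epsilon>>0. \<forall>p\<in>?B. \<forall>q\<in>?B. dist q p < \<epsilon> \<longrightarrow> dist (fst q * snd q ^ k) (fst p * snd p ^ k) < \<eta>'" for k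
  proof -
    have "uniformly_continuous_on ?B (\<lambda>p. fst p * snd p ^ k)"
      by (intro compact_uniformly_continuous continuous_intros compact_Times compact_cball)
    then show ?thesis using \<eta>' unfolding uniformly_continuous_on_def by blast
  qed
  then obtain e where e: "\<And>k. e k > 0"
    "\<And>k p q. p \<in> ?B \<Longrightarrow> q \<in> ?B \<Longrightarrow> dist q p < e k \<Longrightarrow> dist (fst q * snd q ^ k) (fst p * snd p ^ k) < \<eta>'"
    by metis
  \<comment> \<open>The half is there because the errors of both coordinates add up; the inserted 1
    keeps perturbed points within radius \<open>M + 1\<close>.\<close>
  define \<epsilon> where "\<epsilon> = Min (insert 1 (e ` {..n})) / 2"
  have min: "Min (insert 1 (e ` {..n})) > 0" using e(1) by simp
  then have \<epsilon>: "\<epsilon> > 0" by (simp add: \<epsilon>_def)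
  have "2 * \<epsilon> \<le> 1" by (simp add: \<epsilon>_def)
  have \<epsilon>e: "2 * \<epsilon> \<le> e k" if "k \<le> n" for k using that by (simp add: \<epsilon>_def min.coboundedI2)
  show thesis
  proof (rule that[OF \<epsilon>])
    fix x y :: "nat \<Rightarrow> complex" and u v :: complex
    assume xy: "\<And>k. k \<le> n \<Longrightarrow> norm (x k) \<le> M \<and> norm (y k - x k) < \<epsilon>"
      and u: "norm u \<le> M" and v: "norm (v - u) < \<epsilon>"
    have v1: "norm v \<le> M + 1"
      using norm_triangle_sub[of v u] u v \<open>2 * \<epsilon> \<le> 1\<close> \<epsilon> by linarith
    have "norm (y k * v ^ k - x k * u ^ k) < \<eta>'" if k: "k \<le> n" for k
    proof -
      have y1: "norm (y k) \<le> M + 1"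
        using norm_triangle_sub[of "y k" "x k"] xy[OF k] \<open>2 * \<epsilon> \<le> 1\<close> \<epsilon> by linarith
      have "dist (y k, v) (x k, u) \<le> dist (y k) (x k) + dist v u"
        unfolding dist_Pair_Pair by (intro sqrt_sum_squares_le_sum) auto
      also have "\<dots> < e k" using xy[OF k] v \<epsilon>e[OF k] by (simp add: dist_norm)
      finally show ?thesis
        using e(2)[of "(x k, u)" "(y k, v)" k] xy[OF k] u y1 v1 by (simp add: dist_norm)
    qed
    then have "(\<Sum>k\<le>n. norm (y k * v ^ k - x k * u ^ k)) < (\<Sum>k\<le>n. \<eta>')"
      by (intro sum_strict_mono) auto
    also have "\<dots> = \<eta>" by (simp add: \<eta>'_def field_simps)
    finally show "norm ((\<Sum>k\<le>n. y k * v ^ k) - (\<Sum>k\<le>n. x k * u ^ k)) < \<eta>"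
      unfolding sum_subtractf[symmetric] by (rule le_less_trans[OF norm_sum])
  qed
qed

section \<open>Nonvanishing on open sets by the identity theorem\<close>

lemma holomorphic_nonzero_in_open:
  assumes "f holomorphic_on S" "open S" "connected S" "open U" "U \<noteq> {}" "U \<subseteq> S" "z \<in> S" "f z \<noteq> 0"
  obtains u where "u \<in> U" "f u \<noteq> 0"
  using analytic_continuation_open[OF assms(4,2,5,3,6,1), of "\<lambda>_. 0" z] assms(7,8) by auto

text \<open>Ring elements are 0 off the half-plane, so a nonzero one has a nonzero value inside it,
  and the identity theorem carries this to every open subset.\<close>

lemma dirichlet_ring_nonzero_in_open:
  assumes "c \<in> dirichlet_ring" "c \<noteq> 0" "open U" "U \<noteq> {}" "U \<subseteq> {s. 1/2 < Re s}"
  obtains u where "u \<in> U" "c u \<noteq> 0"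
proof -
  obtain z where z: "c z \<noteq> 0" using assms(2) by (auto simp: fun_eq_iff)
  then have "z \<in> {s. 1/2 < Re s}" using assms(1) unfolding dirichlet_ring_def by (force simp: not_less)
  from holomorphic_nonzero_in_open[OF dirichlet_ring_holomorphic[OF assms(1)] open_halfspace_Re_gt
      convex_connected[OF convex_halfspace_Re_gt] assms(3-5) this z] that
  show thesis by blast
qed

subsection \<open>Zeros from approximations\<close>

lemma open_strip: "open strip"
proof -
  have "strip = {s. 1/2 < Re s} \<inter> {s. Re s < 1}" by (auto simp: strip_def)
  then show ?thesis by (elim ssubst) (intro open_Int open_halfspace_Re_gt open_halfspace_Re_lt)
qed

lemma connected_strip: "connected strip"
proof -
  have "strip = {s. 1/2 < Re s} \<inter> {s. Re s < 1}" by (auto simp: strip_def)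
  then show ?thesis
    by (elim ssubst) (intro convex_connected convex_Int convex_halfspace_Re_gt convex_halfspace_Re_lt)
qed

lemma holomorphic_on_vertical_shift:
  assumes "F holomorphic_on strip" "K \<subseteq> strip"
  shows "(\<lambda>z. F (z + \<i> * of_real \<tau>)) holomorphic_on K"
proof -
  have "(F \<circ> (\<lambda>z. z + \<i> * of_real \<tau>)) holomorphic_on K"
    by (rule holomorphic_on_compose_gen[OF _ assms(1)]) (use assms(2) in \<open>auto intro!: holomorphic_intros simp: strip_def\<close>)
  then show ?thesis by (simp add: o_def)
qed

text \<open>Continuity and compactness make the set of norms bounded, so that \<open>Sup\<close>
  really is an upper bound.\<close>

lemma sup_norm_onD:
  assumes "compact K" "continuous_on K g" "sup_norm_on K g < \<epsilon>" "s \<in> K"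
  shows "norm (g s) < \<epsilon>"
proof -
  have "bounded ((\<lambda>s. norm (g s)) ` K)"
    by (intro compact_imp_bounded compact_continuous_image continuous_on_norm assms)
  then have "bdd_above (insert 0 ((\<lambda>s. norm (g s)) ` K))"
    by (simp add: bounded_imp_bdd_above)
  then have "norm (g s) \<le> sup_norm_on K g"
    unfolding sup_norm_on_def using assms(4) by (intro cSup_upper) auto
  then show ?thesis using assms(3) by simp
qed

text \<open>All \<open>\<theta>\<close> are set to 0, which asks that \<open>\<tau>\<close> be an
  approximate common period. Any \<open>d\<close> strictly between 0 and the lower limit is
  eventually exceeded by the density.\<close>

lemma hybrid_approx_density:
  assumes "hybrid_approx L K f" "rat_lin_indep k \<alpha>" "\<epsilon> > 0"
  obtains d where "d > 0" "\<forall>\<^sub>F T in at_top. density_upto T (\<lambda>\<tau>.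
      sup_norm_on K (\<lambda>s. L (s + \<i> * of_real \<tau>) - f s) < \<epsilon> \<and>
      (\<forall>j\<in>{1..k}. dist_nearest_int (\<tau> * \<alpha> j) < \<epsilon>)) > d"
proof -
  let ?D = "\<lambda>T. ereal (density_upto T (\<lambda>\<tau>.
      sup_norm_on K (\<lambda>s. L (s + \<i> * of_real \<tau>) - f s) < \<epsilon> \<and>
      (\<forall>j\<in>{1..k}. dist_nearest_int (\<tau> * \<alpha> j - 0) < \<epsilon>)))"
  have "Liminf at_top ?D > 0"
    using assms unfolding hybrid_approx_def by (elim allE[of _ k] allE[of _ \<alpha>] allE[of _ "\<lambda>_. 0"] allE[of _ \<epsilon>]) simp
  then obtain d where "0 < ereal d" "ereal d < Liminf at_top ?D"
    using ereal_dense2 by blast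
  then show thesis
    using that[of d] less_LiminfD[of "ereal d" at_top ?D] by simp
qed

text \<open>A zero can come only from shifts \<open>\<tau>\<close> in an interval of length
  \<open>2 * r\<close>. The intervals of all zeros cover the good shifts, so their number is at
  least the measure of the good shifts divided by \<open>2 * r\<close>.\<close>

lemma zero_count_from_shifted_zeros:
  assumes F: "F holomorphic_on strip" "s1 \<in> strip" "F s1 \<noteq> 0"
    and \<sigma>: "1/2 < \<sigma>1" "\<sigma>2 < 1"
    and r: "r > 0" "\<And>z. z \<in> ball s0 r \<Longrightarrow> \<sigma>1 < Re z \<and> Re z < \<sigma>2 \<and> 0 < Im z"
    and d: "d > 0" "\<forall>\<^sub>F T in at_top. density_upto T Q > d"
    and zero: "\<And>\<tau>. Q \<tau> \<Longrightarrow> \<exists>z\<in>ball s0 r. F (z + \<i> * of_real \<tau>) = 0"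
  shows "\<exists>C>0. \<forall>\<^sub>F T in at_top.
           real (card {s. \<sigma>1 < Re s \<and> Re s < \<sigma>2 \<and> 0 < Im s \<and> Im s < T \<and> F s = 0}) > C * T"
proof -
  define Z where "Z T = {s. \<sigma>1 < Re s \<and> Re s < \<sigma>2 \<and> 0 < Im s \<and> Im s < T \<and> F s = 0}" for T
  \<comment> \<open>The covering argument and \<open>card\<close> need finitely many zeros; the
    nonzero value at \<open>s1\<close> excludes the zero function.\<close>
  have finZ: "finite (Z T)" for T
  proof (cases "F constant_on strip")
    case True
    then have "F z \<noteq> 0" if "z \<in> strip" for z
      using F(2,3) that unfolding constant_on_def by metis
    then have "Z T = {}" using \<sigma> by (force simp: Z_def strip_def)
    then show ?thesis by simp
  next
    case False
    have "cbox (Complex \<sigma>1 0) (Complex \<sigma>2 T) \<subseteq> strip"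
      using \<sigma> by (auto simp: in_cbox_complex_iff strip_def)
    from holomorphic_compact_finite_zeros[OF F(1) open_strip connected_strip compact_cbox this False]
    show ?thesis by (rule finite_subset[rotated]) (auto simp: Z_def in_cbox_complex_iff)
  qed
  \<comment> \<open>A zero produced by a shift of at most \<open>T\<close> has imaginary part below
    \<open>T + B\<close>.\<close>
  define B where "B = Im s0 + r"
  have B: "B > 0" using r(1) r(2)[of s0] by (simp add: B_def)
  have key: "d * T < 2 * r * card (Z (T + B))" if T: "T > 0" "density_upto T Q > d" for T
  proof -
    define A where "A = {\<tau> \<in> {0..T}. Q \<tau>}"
    define J where "J z = {Im z - Im s0 - r .. Im z - Im s0 + r}" for z
    have dT: "d * T < measure lebesgue A" using T unfolding density_upto_def A_def by (simp add: field_simps)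
    then have "measure lebesgue A \<noteq> 0" using T d(1) by (smt (verit) mult_pos_pos)
    \<comment> \<open>\<open>measure\<close> is 0 on non-measurable sets, so positive density itself
      yields measurability.\<close>
    then have Am: "A \<in> sets lebesgue" using measure_notin_sets by blast
    have sub: "A \<subseteq> (\<Union>z\<in>Z (T + B). J z)"
    proof
      fix \<tau> assume \<tau>: "\<tau> \<in> A"
      then obtain z where z: "z \<in> ball s0 r" "F (z + \<i> * of_real \<tau>) = 0"
        using zero[of \<tau>] by (auto simp: A_def)
      have "\<bar>Im (s0 - z)\<bar> < r" using z(1) abs_Im_le_cmod[of "s0 - z"] by (simp add: dist_norm)
      then have im: "Im s0 - r < Im z" "Im z < Im s0 + r" by auto
      have "z + \<i> * of_real \<tau> \<in> Z (T + B)"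
        using r(2)[OF z(1)] z(2) \<tau> im by (auto simp: Z_def A_def B_def)
      moreover have "\<tau> \<in> J (z + \<i> * of_real \<tau>)" using im by (simp add: J_def)
      ultimately show "\<tau> \<in> (\<Union>z\<in>Z (T + B). J z)" by blast
    qed
    have "measure lebesgue A \<le> measure lebesgue (\<Union>z\<in>Z (T + B). J z)"
      by (rule measure_mono_fmeasurable[OF sub Am], rule fmeasurable.finite_UN[OF finZ]) (simp add: J_def)
    also have "\<dots> \<le> (\<Sum>z\<in>Z (T + B). measure lebesgue (J z))"
      by (rule measure_UNION_le[OF finZ]) (simp add: J_def)
    also have "\<dots> = 2 * r * card (Z (T + B))" using r(1) by (simp add: J_def)
    finally show ?thesis using dT by linarith
  qed
  obtain T0 where T0: "\<And>T. T \<ge> T0 \<Longrightarrow> density_upto T Q > d"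
    using d(2) unfolding eventually_at_top_linorder by blast
  \<comment> \<open>Beyond \<open>2 * B\<close> the loss of \<open>B\<close> in height costs at most
    a factor 2, hence \<open>4 * r\<close> in place of \<open>2 * r\<close>.\<close>
  have "d / (4 * r) * T < card (Z T)" if T: "T \<ge> max (T0 + B) (2 * B)" for T
  proof -
    have "d * (T - B) < 2 * r * card (Z (T - B + B))" using T B by (intro key T0) auto
    moreover have "d * (T / 2) \<le> d * (T - B)" using T d(1) by (intro mult_left_mono) auto
    ultimately have "d * (T / 2) < 2 * r * card (Z T)" by simp
    then show ?thesis using r(1) by (simp add: field_simps)
  qed
  then have "\<forall>\<^sub>F T in at_top. real (card (Z T)) > d / (4 * r) * T"
    unfolding eventually_at_top_linorder by blast
  then show ?thesis unfolding Z_def using d(1) r(1) by (intro exI[of _ "d / (4 * r)"]) simp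
qed

text \<open>Linear growth in a single substrip already exceeds any finite total; the substrip from
  \<open>6/10\<close> to \<open>7/10\<close> is an arbitrary sample.\<close>

lemma has_many_zerosI:
  assumes "\<And>\<sigma>1 \<sigma>2. 1/2 < \<sigma>1 \<Longrightarrow> \<sigma>1 < \<sigma>2 \<Longrightarrow> \<sigma>2 < 1 \<Longrightarrow>
        \<exists>C>0. \<forall>\<^sub>F T in at_top.
           real (card {s. \<sigma>1 < Re s \<and> Re s < \<sigma>2 \<and> 0 < Im s \<and> Im s < T \<and> F s = 0}) > C * T"
  shows "has_many_zeros F"
proof -
  have "infinite {s \<in> strip. F s = 0}"
  proof
    assume fin: "finite {s \<in> strip. F s = 0}"
    let ?Z = "\<lambda>T. {s. 6/10 < Re s \<and> Re s < 7/10 \<and> 0 < Im s \<and> Im s < T \<and> F s = 0}"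
    obtain C where C: "C > 0" "\<forall>\<^sub>F T in at_top. real (card (?Z T)) > C * T"
      using assms[of "6/10" "7/10"] by auto
    have "\<forall>\<^sub>F T in at_top. T \<ge> real (card {s \<in> strip. F s = 0}) / C" by (rule eventually_ge_at_top)
    with C(2) have "\<forall>\<^sub>F T::real in at_top. False"
    proof eventually_elim
      case (elim T)
      have "card (?Z T) \<le> card {s \<in> strip. F s = 0}"
        by (rule card_mono[OF fin]) (auto simp: strip_def)
      moreover have "real (card {s \<in> strip. F s = 0}) \<le> C * T"
        using elim(2) C(1) by (simp add: field_simps)
      ultimately show False using elim(1) by linarith
    qed
    then show False by simp
  qed
  then show ?thesis using assms unfolding has_many_zeros_def by blast
qed

text \<open>The target is linear, \<open>w + a (s - s0)\<close>: the slope \<open>a\<close> keeps \<open>P\<^sub>s(w + a (s - s0))\<close>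
  from vanishing identically, as it could for the constant \<open>w\<close>.\<close>
lemma many_zeros_near_root:
  assumes L: "L holomorphic_on strip" and P: "P \<in> dirichlet_polys"
    and \<sigma>: "1/2 < \<sigma>1" "\<sigma>2 < 1" and s0: "\<sigma>1 < Re s0" "Re s0 < \<sigma>2" "0 < Im s0"
    and lead: "coeff P (degree P) s0 \<noteq> 0"
    and root: "poly (map_poly (\<lambda>c. c s0) P) w = 0"
    and approx: "\<And>K f. compact K \<Longrightarrow> K \<subseteq> strip \<Longrightarrow> connected (- K) \<Longrightarrow> f \<in> H0 K \<Longrightarrow>
        (w \<noteq> 0 \<Longrightarrow> f \<in> H K) \<Longrightarrow> hybrid_approx L K f"
  shows "\<exists>C>0. \<forall>\<^sub>F T in at_top.
    real (card {s. \<sigma>1 < Re s \<and> Re s < \<sigma>2 \<and> 0 < Im s \<and> Im s < T \<and> eval_at_fun P L s = 0}) > C * T"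
proof -
  define n where "n = degree P"
  define F where "F = eval_at_fun P L"
  define V where "V = {s. \<sigma>1 < Re s} \<inter> {s. Re s < \<sigma>2} \<inter> {s. 0 < Im s}"
  have V: "open V" "s0 \<in> V" "V \<subseteq> strip" "V \<subseteq> {s. 1/2 < Re s}"
    using s0 \<sigma> by (auto simp: V_def strip_def intro!: open_Int open_halfspace_Re_gt open_halfspace_Re_lt open_halfspace_Im_gt)
  have strip_sub: "strip \<subseteq> {s. 1/2 < Re s}" by (auto simp: strip_def)
  have ring: "coeff P k \<in> dirichlet_ring" for k using P by (simp add: dirichlet_polys_def)
  have hol: "coeff P k holomorphic_on S" if "S \<subseteq> {s. 1/2 < Re s}" for k S
    by (rule holomorphic_on_subset[OF dirichlet_ring_holomorphic[OF ring] that])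
  have "continuous_on V (coeff P n)"
    using hol V by (intro holomorphic_on_imp_continuous_on) auto
  then have "open (V \<inter> coeff P n -` (- {0}))"
    using V(1) by (intro continuous_open_preimage) auto
  moreover have "s0 \<in> V \<inter> coeff P n -` (- {0})" using V(2) lead by (simp add: n_def)
  ultimately obtain \<rho> where \<rho>: "\<rho> > 0" "ball s0 \<rho> \<subseteq> V \<inter> coeff P n -` (- {0})"
    using open_contains_ball by metis
  \<comment> \<open>A second point of the disc. The leading coefficient is nonzero there too, so the
    polynomial specialised at \<open>s1\<close> has a non-root \<open>y\<close>.\<close>
  define s1 where "s1 = s0 + of_real (\<rho> / 2)"
  have s1: "s1 \<in> ball s0 \<rho>" "s1 \<noteq> s0" using \<rho>(1) by (auto simp: s1_def dist_norm)
  have "coeff (map_poly (\<lambda>c. c s1) P) n \<noteq> 0"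
    using s1(1) \<rho>(2) by (auto simp: coeff_map_poly)
  then have "finite {y. poly (map_poly (\<lambda>c. c s1) P) y = 0}"
    by (intro poly_roots_finite) auto
  then obtain y where y: "poly (map_poly (\<lambda>c. c s1) P) y \<noteq> 0"
    using ex_new_if_finite[OF infinite_UNIV_char_0] by blast
  \<comment> \<open>The slope for which the line through \<open>w\<close> at \<open>s0\<close> takes
    the value \<open>y\<close> at \<open>s1\<close>; thus \<open>G\<close> is not identically 0 and
    its zero at \<open>s0\<close> is isolated.\<close>
  define a where "a = (y - w) / (s1 - s0)"
  define f where "f s = w + a * (s - s0)" for s
  have f_hol: "f holomorphic_on S" for S unfolding f_def[abs_def] by (intro holomorphic_intros)
  have f_cont: "continuous_on S f" for S by (rule holomorphic_on_imp_continuous_on[OF f_hol])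
  have f01: "f s0 = w" "f s1 = y" using s1(2) by (auto simp: f_def a_def)
  define G where "G = eval_at_fun P f"
  have G01: "G s0 = 0" "G s1 \<noteq> 0" using root y by (auto simp: G_def eval_at_fun_conv_poly f01)
  have G_hol: "G holomorphic_on ball s0 \<rho>"
    unfolding G_def by (rule eval_at_fun_holomorphic[OF P f_hol]) (use \<rho>(2) V(4) in blast)
  obtain r1 where r1: "r1 > 0" "ball s0 r1 \<subseteq> ball s0 \<rho>" "\<And>z. z \<in> ball s0 r1 - {s0} \<Longrightarrow> G z \<noteq> 0"
    using isolated_zeros[OF G_hol open_ball connected_ball _ G01(1) s1(1) G01(2)] \<rho>(1) by auto
  \<comment> \<open>On this disc a target with \<open>w \<noteq> 0\<close> is zero-free, as
    membership in \<open>H K\<close> demands. For \<open>w = 0\<close> the radius 1 is only a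
    placeholder.\<close>
  obtain r2 where r2: "r2 > 0" "w \<noteq> 0 \<Longrightarrow> \<forall>z\<in>ball s0 r2. f z \<noteq> 0"
  proof (cases "w = 0")
    case False
    have "open (UNIV \<inter> f -` (- {0}))" by (rule continuous_open_preimage[OF f_cont]) auto
    then obtain r2 where "r2 > 0" "ball s0 r2 \<subseteq> UNIV \<inter> f -` (- {0})"
      using False f01(1) by (auto elim!: openE[where x = s0])
    then show thesis using that[of r2] by blast
  qed (use that[of 1] in simp)
  define r where "r = min r1 r2 / 2"
  have r: "r > 0" "r < r1" "r < r2" using r1(1) r2(1) by (auto simp: r_def)
  define K where "K = cball s0 r"
  have K: "compact K" "connected (- K)"
    unfolding K_def by (auto intro!: connected_complement_bounded_convex)
  have "K \<subseteq> ball s0 r1" using r(2) by (auto simp: K_def)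
  then have KV: "K \<subseteq> V" using r1(2) \<rho>(2) by blast
  have K_sub: "K \<subseteq> strip" "K \<subseteq> {s. 1/2 < Re s}" using KV V by auto
  have "f \<in> H0 K" using f_hol f_cont by (simp add: H0_def)
  moreover have "f \<in> H K" if "w \<noteq> 0"
    using r2(2)[OF that] r(3) \<open>f \<in> H0 K\<close> by (auto simp: H_def K_def)
  ultimately have hyb: "hybrid_approx L K f" using approx K K_sub by blast

  have "continuous_on (sphere s0 r) (\<lambda>z. norm (G z))"
    using r(2) r1(2) by (intro continuous_on_norm continuous_on_subset[OF holomorphic_on_imp_continuous_on[OF G_hol]]) auto
  moreover have "sphere s0 r \<noteq> {}" using r(1) by simp
  ultimately obtain x where x: "x \<in> sphere s0 r" "\<And>z. z \<in> sphere s0 r \<Longrightarrow> norm (G x) \<le> norm (G z)"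
    using continuous_attains_inf[OF compact_sphere] by metis
  \<comment> \<open>The minimum of the modulus of \<open>G\<close> on the circle, positive because
    \<open>s0\<close> is the only zero of \<open>G\<close> in the larger disc. An error below
    \<open>\<eta> / 3\<close> keeps the shifted \<open>F\<close> below \<open>\<eta> / 3\<close> at
    the centre and above \<open>2 * \<eta> / 3\<close> on the circle.\<close>
  define \<eta> where "\<eta> = norm (G x)"
  have \<eta>: "\<eta> > 0" using r1(3)[of x] x(1) r by (auto simp: \<eta>_def)
  have "bounded ((\<Union>k\<le>n. coeff P k ` K) \<union> f ` K)"
    using K(1) f_hol hol[OF K_sub(2)]
    by (intro bounded_Un[THEN iffD2] conjI bounded_UN finite_atMost ballI compact_imp_bounded compact_continuous_image holomorphic_on_imp_continuous_on) auto
  then obtain M where bnd: "\<forall>z\<in>(\<Union>k\<le>n. coeff P k ` K) \<union> f ` K. norm z \<le> M"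
    unfolding bounded_iff by (rule exE)
  have M: "norm (f s) \<le> M" "\<And>k. k \<le> n \<Longrightarrow> norm (coeff P k s) \<le> M" if "s \<in> K" for s
    using that by (auto intro!: bnd[rule_format])
  have "\<eta> / 3 > 0" using \<eta> by simp
  then obtain \<epsilon> where \<epsilon>: "\<epsilon> > 0" and cont: "\<And>x y (u::complex) v.
       (\<And>k. k \<le> n \<Longrightarrow> norm (x k) \<le> M \<and> norm (y k - x k) < \<epsilon>) \<Longrightarrow> norm u \<le> M \<Longrightarrow>
       norm (v - u) < \<epsilon> \<Longrightarrow> norm ((\<Sum>k\<le>n. y k * v ^ k) - (\<Sum>k\<le>n. x k * u ^ k)) < \<eta> / 3"
    using power_sum_uniformly_continuous[of "\<eta> / 3" n M] by blast
  have "\<sigma>1 \<le> \<sigma>2" using s0 by simp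
  from dirichlet_ring_family_almost_periodic[where c = "coeff P", OF ring finite_atMost[of n] \<sigma>(1) this \<epsilon>]
  obtain m \<alpha> \<delta> where ap: "rat_lin_indep m \<alpha>" "\<delta> > 0"
    "\<forall>\<tau>. (\<forall>j\<in>{1..m}. dist_nearest_int (\<tau> * \<alpha> j) < \<delta>) \<longrightarrow>
      (\<forall>k\<in>{..n}. \<forall>s. \<sigma>1 \<le> Re s \<and> Re s \<le> \<sigma>2 \<longrightarrow> norm (coeff P k (s + \<i> * of_real \<tau>) - coeff P k s) < \<epsilon>)"
    by (elim exE conjE)
  define e where "e = min \<epsilon> \<delta>"
  have "e > 0" using \<epsilon> ap(2) by (simp add: e_def)
  define Q where "Q \<tau> \<longleftrightarrow> sup_norm_on K (\<lambda>s. L (s + \<i> * of_real \<tau>) - f s) < e \<and>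
      (\<forall>j\<in>{1..m}. dist_nearest_int (\<tau> * \<alpha> j) < e)" for \<tau>
  obtain d where d: "d > 0" "\<forall>\<^sub>F T in at_top. density_upto T Q > d"
    using hybrid_approx_density[OF hyb ap(1) \<open>e > 0\<close>] unfolding Q_def[abs_def] .
  \<comment> \<open>For a good shift both the coefficients and the argument of the polynomial move
    by less than \<open>\<epsilon>\<close>, so uniform continuity of the power sum applies.\<close>
  have close: "norm (F (s + \<i> * of_real \<tau>) - G s) < \<eta> / 3" if Q: "Q \<tau>" and s: "s \<in> K" for \<tau> s
  proof -
    have Vs: "s \<in> V" using s KV by blast
    have "norm (L (s + \<i> * of_real \<tau>) - f s) < e"
      by (rule sup_norm_onD[OF K(1) _ _ s])
        (use Q f_cont holomorphic_on_imp_continuous_on[OF holomorphic_on_vertical_shift[OF L K_sub(1)]]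
          in \<open>auto simp: Q_def intro!: continuous_intros\<close>)
    then have "norm (L (s + \<i> * of_real \<tau>) - f s) < \<epsilon>" by (simp add: e_def)
    moreover have "norm (f s) \<le> M" by (rule M(1)[OF s])
    moreover have "norm (coeff P k s) \<le> M \<and> norm (coeff P k (s + \<i> * of_real \<tau>) - coeff P k s) < \<epsilon>"
      if "k \<le> n" for k
      using M(2)[OF s that] that ap(3)[rule_format, of \<tau> k s] Q Vs by (auto simp: Q_def e_def V_def)
    ultimately show ?thesis
      unfolding F_def G_def eval_at_fun_def n_def[symmetric] by (intro cont)
  qed
  have F_hol: "F holomorphic_on strip"
    unfolding F_def by (rule eval_at_fun_holomorphic[OF P L strip_sub])
  have large: "norm (F (z + \<i> * of_real \<tau>)) > 2 * \<eta> / 3" if "Q \<tau>" "z \<in> sphere s0 r" for \<tau> z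
  proof -
    have "z \<in> K" using that(2) by (simp add: K_def)
    from close[OF that(1) this] have "norm (G z) - norm (F (z + \<i> * of_real \<tau>)) < \<eta> / 3"
      using norm_triangle_ineq2[of "G z" "F (z + \<i> * of_real \<tau>)"] by (simp add: norm_minus_commute)
    then show ?thesis using x(2)[OF that(2)] by (simp add: \<eta>_def)
  qed
  have zero: "\<exists>z\<in>ball s0 r. F (z + \<i> * of_real \<tau>) = 0" if Q: "Q \<tau>" for \<tau>
  proof -
    have "s0 \<in> K" using r(1) by (simp add: K_def)
    from close[OF Q this] have small: "norm (F (s0 + \<i> * of_real \<tau>)) < \<eta> / 3" by (simp add: G01(1))
    have hK: "(\<lambda>z. F (z + \<i> * of_real \<tau>)) holomorphic_on cball s0 r"
      using holomorphic_on_vertical_shift[OF F_hol K_sub(1)] by (simp add: K_def)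
    have less: "norm (F (s0 + \<i> * of_real \<tau>)) < norm (F (z + \<i> * of_real \<tau>))" if "norm (s0 - z) = r" for z
      using large[OF Q, of z] small that \<eta> by (simp add: dist_norm)
    \<comment> \<open>Minimum modulus principle: a value at the centre smaller than all boundary
      values forces a zero inside.\<close>
    show ?thesis
      using holomorphic_contract_to_zero[OF holomorphic_on_imp_continuous_on[OF hK]
          holomorphic_on_subset[OF hK ball_subset_cball] r(1) less] by metis
  qed
  \<comment> \<open>A single good shift supplies the point where \<open>F\<close> is nonzero that
    the zero count requires.\<close>
  have "\<exists>\<tau>. Q \<tau>"
  proof (rule ccontr)
    assume "\<nexists>\<tau>. Q \<tau>"
    then have "density_upto T Q = 0" for T by (simp add: density_upto_def)
    with d have "\<forall>\<^sub>F T::real in at_top. False" by simp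
    then show False by simp
  qed
  then obtain \<tau> where "Q \<tau>" by blast
  from large[OF this x(1)] have "F (x + \<i> * of_real \<tau>) \<noteq> 0" using \<eta> by auto
  moreover have "x \<in> strip" using x(1) K_sub(1) by (auto simp: K_def)
  then have "x + \<i> * of_real \<tau> \<in> strip" by (simp add: strip_def)
  moreover have "\<sigma>1 < Re z \<and> Re z < \<sigma>2 \<and> 0 < Im z" if "z \<in> ball s0 r" for z
    using that KV by (force simp: K_def V_def)
  ultimately show ?thesis
    using zero_count_from_shifted_zeros[OF F_hol _ _ \<sigma> r(1) _ d zero] unfolding F_def by blast
qed

section \<open>Choice of the base point and of the root\<close>

theorem theorem1:
  fixes L :: "complex \<Rightarrow> complex" and P :: "(complex \<Rightarrow> complex) poly"
  assumes "L holomorphic_on strip"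
    and "hybridly_universal L"
    and "P \<in> dirichlet_polys"
    and "degree P > 0"
  shows "(\<not> is_monomial P \<longrightarrow> has_many_zeros (eval_at_fun P L)) \<and>
    (hybridly_strongly_universal L \<longrightarrow> has_many_zeros (eval_at_fun P L))"
proof -
  define n where "n = degree P"
  have lead: "coeff P n \<noteq> 0" using assms(4) by (auto simp: n_def)
  have ring: "coeff P k \<in> dirichlet_ring" for k using assms(3) by (simp add: dirichlet_polys_def)
  \<comment> \<open>The identity theorem is used twice: first for the leading coefficient on the
    box, then for the other one on the open subset where the leading one is nonzero.\<close>
  have base: "\<exists>s0. \<sigma>1 < Re s0 \<and> Re s0 < \<sigma>2 \<and> 0 < Im s0 \<and> coeff P n s0 \<noteq> 0 \<and> coeff P m s0 \<noteq> 0"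
    if \<sigma>: "1/2 < \<sigma>1" "\<sigma>1 < \<sigma>2" "\<sigma>2 < 1" and m: "coeff P m \<noteq> 0" for \<sigma>1 \<sigma>2 m
  proof -
    define V where "V = {s. \<sigma>1 < Re s} \<inter> {s. Re s < \<sigma>2} \<inter> {s. 0 < Im s}"
    have V: "open V" "V \<subseteq> {s. 1/2 < Re s}"
      using \<sigma> by (auto simp: V_def intro!: open_Int open_halfspace_Re_gt open_halfspace_Re_lt open_halfspace_Im_gt)
    have "Complex ((\<sigma>1 + \<sigma>2) / 2) 1 \<in> V" using \<sigma> by (simp add: V_def)
    then have "V \<noteq> {}" by blast
    then obtain u where u: "u \<in> V" "coeff P n u \<noteq> 0"
      using dirichlet_ring_nonzero_in_open[OF ring lead V(1) _ V(2)] by blast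
    define U where "U = V \<inter> coeff P n -` (- {0})"
    have "continuous_on V (coeff P n)"
      by (intro holomorphic_on_imp_continuous_on holomorphic_on_subset[OF dirichlet_ring_holomorphic[OF ring] V(2)])
    then have "open U" unfolding U_def using V(1) by (intro continuous_open_preimage) auto
    moreover have "U \<noteq> {}" using u by (auto simp: U_def)
    moreover have "U \<subseteq> {s. 1/2 < Re s}" using V(2) by (auto simp: U_def)
    ultimately obtain s0 where "s0 \<in> U" "coeff P m s0 \<noteq> 0"
      using dirichlet_ring_nonzero_in_open[OF ring m] by blast
    then show ?thesis by (auto simp: U_def V_def)
  qed
  show ?thesis
  proof (intro conjI impI)
    assume "\<not> is_monomial P"
    then obtain m where m: "coeff P m \<noteq> 0" "m \<noteq> n" using lead by (auto simp: is_monomial_def)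
    show "has_many_zeros (eval_at_fun P L)"
    proof (rule has_many_zerosI)
      fix \<sigma>1 \<sigma>2 :: real assume \<sigma>: "1/2 < \<sigma>1" "\<sigma>1 < \<sigma>2" "\<sigma>2 < 1"
      obtain s0 where s0: "\<sigma>1 < Re s0" "Re s0 < \<sigma>2" "0 < Im s0" "coeff P n s0 \<noteq> 0" "coeff P m s0 \<noteq> 0"
        using base[OF \<sigma> m(1)] by blast
      \<comment> \<open>Two coefficients survive at \<open>s0\<close>, so a nonzero root exists and
        plain universality, limited to zero-free targets, suffices.\<close>
      obtain w where w: "w \<noteq> 0" "poly (map_poly (\<lambda>c. c s0) P) w = 0"
        using poly_nonzero_root[of "map_poly (\<lambda>c. c s0) P" m n] s0 m(2) by (auto simp: coeff_map_poly)
      show "\<exists>C>0. \<forall>\<^sub>F T in at_top. real (card {s. \<sigma>1 < Re s \<and> Re s < \<sigma>2 \<and> 0 < Im s \<and> Im s < T \<and>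
          eval_at_fun P L s = 0}) > C * T"
        by (rule many_zeros_near_root[OF assms(1,3) \<sigma>(1,3) s0(1-3) s0(4)[unfolded n_def] w(2)])
          (use assms(2) w(1) in \<open>simp add: hybridly_universal_def\<close>)
    qed
  next
    assume strong: "hybridly_strongly_universal L"
    show "has_many_zeros (eval_at_fun P L)"
    proof (rule has_many_zerosI)
      fix \<sigma>1 \<sigma>2 :: real assume \<sigma>: "1/2 < \<sigma>1" "\<sigma>1 < \<sigma>2" "\<sigma>2 < 1"
      obtain s0 where s0: "\<sigma>1 < Re s0" "Re s0 < \<sigma>2" "0 < Im s0" "coeff P n s0 \<noteq> 0"
        using base[OF \<sigma> lead] by blast
      \<comment> \<open>The degree does not drop at \<open>s0\<close>, so some root exists. It may
        be 0, as for a monomial, which strong universality permits.\<close>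
      have "coeff (map_poly (\<lambda>c. c s0) P) n \<noteq> 0" using s0(4) by (simp add: coeff_map_poly)
      then have "degree (map_poly (\<lambda>c. c s0) P) \<noteq> 0"
        using assms(4) le_degree[of "map_poly (\<lambda>c. c s0) P" n] by (simp add: n_def)
      then obtain w where w: "poly (map_poly (\<lambda>c. c s0) P) w = 0"
        using Fundamental_Theorem_Algebra.fundamental_theorem_of_algebra by (metis constant_degree)
      show "\<exists>C>0. \<forall>\<^sub>F T in at_top. real (card {s. \<sigma>1 < Re s \<and> Re s < \<sigma>2 \<and> 0 < Im s \<and> Im s < T \<and>
          eval_at_fun P L s = 0}) > C * T"
        by (rule many_zeros_near_root[OF assms(1,3) \<sigma>(1,3) s0(1-3) s0(4)[unfolded n_def] w])
          (use strong in \<open>simp add: hybridly_strongly_universal_def\<close>)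
    qed
  qed
qed

end
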